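(* There exists an $AP_{3}$-covering sequence $A \subseteq \mathbb{N}$ such that \[ \limsup_{n \rightarrow \infty}\frac{A(n)}{\sqrt{n}} \le 34. \]
   Context: $\mathbb{N}$ denotes the set of all nonnegative integers. For an integer $k\ge 3$, a set (sequence) $A \subseteq \mathbb{N}$ is called an $AP_{k}$-covering sequence if there exists an integer $n_{0}$ such that for every integer $n > n_{0}$ there exist $a_{1}, \dots, a_{k-1} \in A$ with $a_{1} < \cdots < a_{k-1} < n$ such that $a_{1}, \dots, a_{k-1}, n$ form a $k$-term arithmetic progression. For $A\subseteq \mathbb{N}$, $A(n)$ denotes the number of elements of $A$ up to $n$, i.e. $A(n) = |\{a \in A : a \le n\}|$. *)

theory Defs
  imports "HOL-Analysis.Analysis"
begin

text \<open>The terms \<open>a 1, \<dots>, a k\<close> form an arithmetic progression. The common difference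
  is taken in \<^typ>\<open>int\<close>, since subtraction on \<^typ>\<open>nat\<close> truncates.\<close>

definition arith_prog :: "nat \<Rightarrow> (nat \<Rightarrow> nat) \<Rightarrow> bool" where
  "arith_prog k a \<longleftrightarrow> (\<exists>d::int. \<forall>i\<in>{1..<k}. int (a (Suc i)) - int (a i) = d)"

text \<open>Meaningful for \<open>k \<ge> 3\<close>. Only the first \<open>k - 1\<close> terms are required to lie in \<open>A\<close>;
  the last term is \<open>n\<close>. A natural number threshold loses no generality, because \<open>n = 0\<close>
  has no smaller terms and is therefore never covered.\<close>

definition AP_covering :: "nat \<Rightarrow> nat set \<Rightarrow> bool" where
  "AP_covering k A \<longleftrightarrow>
     (\<exists>n\<^sub>0. \<forall>n>n\<^sub>0. \<exists>a. (\<forall>i\<in>{1..k - 1}. a i \<in> A) \<and> a k = n \<and>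
        strict_mono_on {1..k} a \<and> arith_prog k a)"

definition counting :: "nat set \<Rightarrow> nat \<Rightarrow> nat" where
  "counting A n = card {a \<in> A. a \<le> n}"

end

theory Submission
  imports Defs
begin

text \<open>A three-term progression ending in \<open>n\<close> is an identity \<open>n = 2 * a - b\<close> with \<open>b < a\<close>
  (then \<open>a < n\<close> is automatic). For \<open>m \<ge> 2\<close>, every \<open>n\<close> from \<open>m\<^sup>2 + 2 * m\<close> to
  \<open>(2 * m)\<^sup>2 + 2 * (2 * m) - 1\<close> has such a representation in which \<open>b\<close> runs over an interval of
  length \<open>2 * m\<close> starting at \<open>m\<^sup>2\<close> (a complete residue system modulo \<open>2 * m\<close>) and \<open>a\<close> is one
  of \<open>O(m)\<close> consecutive multiples of \<open>m\<close>: see \<open>AP3_from_block\<close>. Such a block has at most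
  \<open>6 * m\<close> elements, all of them at least \<open>m\<^sup>2\<close>. The union of the blocks of scales \<open>m = 2 ^ k\<close>
  therefore covers all \<open>n \<ge> 8\<close>, and if \<open>4 ^ K \<le> n < 4 ^ Suc K\<close>, only the blocks with
  \<open>k \<le> K\<close> meet the numbers up to \<open>n\<close>; the geometric series bounds the count by
  \<open>12 * 2 ^ K \<le> 12 * sqrt n\<close>, well within the required constant.\<close>

text \<open>The block of scale \<open>m\<close>: the interval supplies the first terms of progressions, the multiples
  of \<open>m\<close> the middle terms.\<close>

definition block :: "nat \<Rightarrow> nat set" where
  "block m = {m\<^sup>2..<m\<^sup>2 + 2 * m} \<union> (\<lambda>j. m * j) ` {m..4 * m}"

lemma finite_block: "finite (block m)"
  by (simp add: block_def)

lemma card_block_le: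
  assumes "m \<ge> 1"
  shows "card (block m) \<le> 6 * m"
proof -
  have "card (block m) \<le> card {m\<^sup>2..<m\<^sup>2 + 2 * m} + card ((\<lambda>j. m * j) ` {m..4 * m})"
    unfolding block_def by (rule card_Un_le)
  also have "\<dots> \<le> 2 * m + (3 * m + 1)"
    using card_image_le[of "{m..4 * m}" "\<lambda>j. m * j"] by simp
  finally show ?thesis using assms by simp
qed

lemma block_lower_bound: "a \<in> block m \<Longrightarrow> m\<^sup>2 \<le> a"
  by (auto simp: block_def power2_eq_square)

lemma AP3_from_block:
  fixes m n :: nat
  assumes m: "m \<ge> 2" and lo: "m\<^sup>2 + 2 * m \<le> n" and hi: "n < (2 * m)\<^sup>2 + 2 * (2 * m)"
  shows "\<exists>a\<in>block m. \<exists>b\<in>block m. b < a \<and> a < n \<and> n + b = 2 * a"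
proof -
  \<comment> \<open>The multiple \<open>2 * m * j\<close> is the least one that is at least \<open>n + m\<^sup>2\<close>.\<close>
  define j where "j = (n + m\<^sup>2 + (2 * m - 1)) div (2 * m)"
  have "2 * m * j + (n + m\<^sup>2 + (2 * m - 1)) mod (2 * m) = n + m\<^sup>2 + (2 * m - 1)"
    unfolding j_def by simp
  moreover have "(n + m\<^sup>2 + (2 * m - 1)) mod (2 * m) < 2 * m"
    using m by simp
  ultimately have j: "n + m\<^sup>2 \<le> 2 * m * j" "2 * m * j < n + m\<^sup>2 + 2 * m"
    using m by linarith+
  define b where "b = 2 * m * j - n"
  have nb: "n + b = 2 * (m * j)" and b: "m\<^sup>2 \<le> b" "b < m\<^sup>2 + 2 * m"
    using j by (auto simp: b_def)
  have "2 * m * m \<le> 2 * m * j"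
    using j(1) lo unfolding power2_eq_square mult.assoc by linarith
  then have "m \<le> j" using m by simp
  moreover have "m * (2 * j) < m * (5 * m + 6)"
    using j(2) hi by (simp add: power2_eq_square algebra_simps)
  then have "j \<le> 4 * m" using m by simp
  ultimately have "m * j \<in> block m" by (auto simp: block_def)
  moreover have "b \<in> block m" using b by (simp add: block_def)
  moreover have "b < m * j" "m * j < n" using nb b lo by linarith+
  ultimately show ?thesis using nb by blast
qed

lemma AP_covering_3I:
  assumes "\<And>n. n > n\<^sub>0 \<Longrightarrow> \<exists>a\<in>A. \<exists>b\<in>A. b < a \<and> a < n \<and> n + b = 2 * a"
  shows "AP_covering 3 A"
  unfolding AP_covering_def
proof (intro exI[of _ n\<^sub>0] allI impI)
  fix n assume "n > n\<^sub>0"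
  then obtain a b where ab: "a \<in> A" "b \<in> A" "b < a" "a < n" "n + b = 2 * a"
    using assms by blast
  define f :: "nat \<Rightarrow> nat" where "f = (\<lambda>i. if i = 1 then b else if i = 2 then a else n)"
  have one_two: "{1..3 - 1} = {1, 2::nat}" "{1..<3} = {1, 2::nat}" by auto
  have one_two_three: "{1..3} = {1, 2, 3::nat}" by auto
  have "\<forall>i\<in>{1..3 - 1}. f i \<in> A"
    unfolding one_two using ab by (simp add: f_def)
  moreover have "f 3 = n" by (simp add: f_def)
  moreover have "strict_mono_on {1..3} f"
    unfolding one_two_three strict_mono_on_def using ab by (auto simp: f_def)
  moreover have "arith_prog 3 f"
    unfolding arith_prog_def one_two
    by (rule exI[of _ "int a - int b"]) (use ab in \<open>auto simp: f_def\<close>)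
  ultimately show "\<exists>f. (\<forall>i\<in>{1..3 - 1}. f i \<in> A) \<and> f 3 = n \<and>
      strict_mono_on {1..3} f \<and> arith_prog 3 f" by blast
qed

lemma AP_covering_dyadic_blocks: "AP_covering 3 (\<Union>k. block (2 ^ k))"
proof (rule AP_covering_3I[of 7])
  fix n :: nat assume n: "n > 7"
  let ?P = "\<lambda>k. n < (2 ^ k)\<^sup>2 + 2 * 2 ^ k"
  have "n < 2 ^ n" by (rule less_exp)
  then have "?P n" by linarith
  moreover have "\<not> ?P 0" using n by simp
  ultimately obtain k where k: "\<not> ?P k" "?P (Suc k)"
    using ex_least_nat_less[of ?P n] by blast
  have "k \<noteq> 0"
  proof
    assume "k = 0"
    with k(2) n show False by simp
  qed
  then have "2 ^ 1 \<le> (2 ^ k :: nat)"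
    by (intro power_increasing) auto
  then have "\<exists>a\<in>block (2 ^ k). \<exists>b\<in>block (2 ^ k). b < a \<and> a < n \<and> n + b = 2 * a"
    using k by (intro AP3_from_block) simp_all
  then show "\<exists>a\<in>\<Union>k. block (2 ^ k). \<exists>b\<in>\<Union>k. block (2 ^ k). b < a \<and> a < n \<and> n + b = 2 * a"
    by blast
qed

lemma counting_dyadic_blocks_le:
  assumes "n \<ge> 1"
  shows "real (counting (\<Union>k. block (2 ^ k)) n) \<le> 12 * sqrt (real n)"
proof -
  obtain K where K: "4 ^ K \<le> n" "n < 4 ^ (K + 1)"
    using ex_power_ivl1[of 4 n] assms by auto
  have square: "((2::nat) ^ k)\<^sup>2 = 4 ^ k" for k
    by (simp add: power_even_eq[symmetric] power_mult)
  have "{a \<in> \<Union>k. block (2 ^ k). a \<le> n} \<subseteq> (\<Union>k\<in>{..<Suc K}. block (2 ^ k))"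
  proof
    fix a assume "a \<in> {a \<in> \<Union>k. block (2 ^ k). a \<le> n}"
    then obtain k where k: "a \<in> block (2 ^ k)" "a \<le> n" by blast
    have "(4::nat) ^ k < 4 ^ (K + 1)"
      using block_lower_bound[OF k(1)] k(2) K(2) square[of k] by linarith
    then have "k < K + 1"
      by (simp only: power_strict_increasing_iff[of "4::nat"])
    with k(1) show "a \<in> (\<Union>k\<in>{..<Suc K}. block (2 ^ k))" by auto
  qed
  then have "counting (\<Union>k. block (2 ^ k)) n \<le> card (\<Union>k\<in>{..<Suc K}. block (2 ^ k))"
    unfolding counting_def by (intro card_mono) (auto simp: finite_block)
  also have "\<dots> \<le> (\<Sum>k<Suc K. card (block (2 ^ k)))"
    by (rule card_UN_le) simp
  also have "\<dots> \<le> (\<Sum>k<Suc K. 6 * 2 ^ k)"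
    by (intro sum_mono card_block_le) simp
  also have "\<dots> = 6 * (2 ^ Suc K - 1)"
    by (simp only: sum_distrib_left[symmetric] mask_eq_sum_exp_nat[symmetric] lessThan_def)
  also have "\<dots> \<le> 12 * 2 ^ K" by simp
  finally have "real (counting (\<Union>k. block (2 ^ k)) n) \<le> 12 * 2 ^ K"
    by (metis of_nat_le_iff of_nat_mult of_nat_numeral of_nat_power)
  also have "(2::real) ^ K \<le> sqrt (real n)"
  proof (rule real_le_rsqrt)
    have "real ((2 ^ K)\<^sup>2) \<le> real n"
      using K(1) unfolding square by (simp only: of_nat_le_iff)
    then show "(2 ^ K)\<^sup>2 \<le> real n" by simp
  qed
  finally show ?thesis by simp
qed

theorem theorem2:
  shows "\<exists>A :: nat set. AP_covering 3 A \<and>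
    limsup (\<lambda>n. ereal (real (counting A n) / sqrt (real n))) \<le> 34"
proof (intro exI conjI)
  show "AP_covering 3 (\<Union>k. block (2 ^ k))"
    by (rule AP_covering_dyadic_blocks)
  show "limsup (\<lambda>n. ereal (real (counting (\<Union>k. block (2 ^ k)) n) / sqrt (real n))) \<le> 34"
  proof (rule Limsup_bounded, rule eventually_mono[OF eventually_ge_at_top[of 1]])
    fix n :: nat assume n: "1 \<le> n"
    have "real (counting (\<Union>k. block (2 ^ k)) n) / sqrt (real n) \<le> 12"
      using counting_dyadic_blocks_le[OF n] n by (simp add: divide_le_eq)
    then show "ereal (real (counting (\<Union>k. block (2 ^ k)) n) / sqrt (real n)) \<le> 34"
      by simp
  qed
qed

end
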